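(* Consider the FedRK algorithm (described in the context) applied to an overdetermined linear system $Ax=b$ whose solution is $x^*=0$, with a finite number $\tau=T\in\mathbb{N}$, $T\ge 1$, of local iterations per client, with $\tau_g=1$ server iteration per federated round, and with $|S^{(t)}|=N$ for all $t$, where $N\in\mathbb{N}$, $1\le N\le M$, is fixed. Let $X^{(0)}\in\mathbb{R}^n$ be the initial global model and let $X^{(t+1)}$ be the global model after $t+1$ federated rounds. Then there exists $0<\beta<1$ such that $$\mathbb{E}\Vert X^{(t+1)}\Vert^2\le \beta^{t+1}\Vert X^{(0)}\Vert^2,\qquad t=0,1,2,\dotsc.$$
   Context: Setting. $A\in\mathbb{R}^{m\times n}$ and $b\in\mathbb{R}^m$ are partitioned by rows into $M$ blocks $A_1,\dots,A_M$ and $b_1,\dots,b_M$; client $i\in[M]=\{1,\dots,M\}$ holds the system $A_ix=b_i$ (which may be underdetermined). The full system $Ax=b$ is consistent and overdetermined, with unique solution $x^*=0$ (so $b=0$ and $Ax=0$ only for $x=0$). $\Vert\cdot\Vert$ is the Euclidean norm. Randomized Kaczmarz (RK). One RK step for a system with rows $a_j$ and right-hand sides $b_j$ replaces the current point $x$ by $x+\frac{b_j-\langle a_j,x\rangle}{\Vert a_j\Vert^2}a_j$, where $j$ is a randomly sampled row index. For the local systems $A_ix=b_i$, row $j$ of $A_i$ is sampled with probability $\Vert a_j\Vert^2/\Vert A_i\Vert_F^2$, independently at each step (if $A_i=0$ the local model is left unchanged). FedRK. Start from the deterministic initial model $X^{(0)}$. In round $t=0,1,2,\dots$: (1) a subset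 $S^{(t)}\subseteq[M]$ of clients with $|S^{(t)}|=N$ is sampled uniformly at random among all $N$-element subsets; (2) each client $i\in S^{(t)}$ sets $x_i^{(t,0)}=X^{(t)}$ and performs $\tau$ RK steps on $A_ix=b_i$, producing $x_i^{(t,\tau)}$, and computes $\Delta_i^{(t)}=x_i^{(t,\tau)}-x_i^{(t,0)}$; (3) with $d_i=\langle\Delta_i^{(t)},\Delta_i^{(t)}+X^{(t)}\rangle$ for $i\in S^{(t)}$, the server performs $\tau_g$ RK steps, started at $X^{(t)}$, on the system $\langle\Delta_i^{(t)},x\rangle=d_i$, $i\in S^{(t)}$, ignoring the rows with $\Delta_i^{(t)}=0$ and sampling uniformly among the remaining rows; the result is $X^{(t+1)}$ (if all $\Delta_i^{(t)}=0$, then $X^{(t+1)}=X^{(t)}$). All random choices (client subsets, local rows, server rows) are made independently of each other and of the past, given the current state. *)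

theory Defs
  imports "HOL-Analysis.Analysis" "HOL-Probability.Probability"
begin

definition rk_step :: "real^'n \<Rightarrow> real \<Rightarrow> real^'n \<Rightarrow> real^'n" where
  "rk_step a c x = x + ((c - a \<bullet> x) / (norm a)\<^sup>2) *\<^sub>R a"

text \<open>
  The row partition of \<open>A\<close> and \<open>b\<close> is given by \<open>blk\<close>, which maps each row index to the client
  holding that row; thus \<open>A\<^sub>i\<close> consists of the rows in \<open>block_rows blk i\<close>.
\<close>

definition block_rows :: "('m \<Rightarrow> nat) \<Rightarrow> nat \<Rightarrow> 'm set" where
  "block_rows blk i = {j. blk j = i}"

definition block_frob_sq :: "real^'n^'m \<Rightarrow> ('m::finite \<Rightarrow> nat) \<Rightarrow> nat \<Rightarrow> real" where
  "block_frob_sq A blk i = (\<Sum>j\<in>block_rows blk i. (norm (A $ j))\<^sup>2)"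

text \<open>
  \<open>embed_pmf\<close> is only meaningful for weights summing to 1, hence the row distribution is used only
  for \<open>A\<^sub>i \<noteq> 0\<close>; see \<open>pmf_local_row\<close> below.
\<close>

definition local_row :: "real^'n^'m \<Rightarrow> ('m::finite \<Rightarrow> nat) \<Rightarrow> nat \<Rightarrow> 'm pmf" where
  "local_row A blk i =
     embed_pmf (\<lambda>j. if j \<in> block_rows blk i then (norm (A $ j))\<^sup>2 / block_frob_sq A blk i else 0)"

definition local_step ::
  "real^'n^'m \<Rightarrow> real^'m \<Rightarrow> ('m::finite \<Rightarrow> nat) \<Rightarrow> nat \<Rightarrow> real^'n \<Rightarrow> (real^'n) pmf" where
  "local_step A b blk i x =
     (if \<forall>j\<in>block_rows blk i. A $ j = 0 then return_pmf x
      else map_pmf (\<lambda>j. rk_step (A $ j) (b $ j) x) (local_row A blk i))"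

primrec local_run ::
  "real^'n^'m \<Rightarrow> real^'m \<Rightarrow> ('m::finite \<Rightarrow> nat) \<Rightarrow> nat \<Rightarrow> nat \<Rightarrow> real^'n \<Rightarrow> (real^'n) pmf" where
  "local_run A b blk i 0 x = return_pmf x"
| "local_run A b blk i (Suc k) x = bind_pmf (local_run A b blk i k x) (local_step A b blk i)"

definition local_update ::
  "real^'n^'m \<Rightarrow> real^'m \<Rightarrow> ('m::finite \<Rightarrow> nat) \<Rightarrow> nat \<Rightarrow> real^'n \<Rightarrow> nat \<Rightarrow> (real^'n) pmf" where
  "local_update A b blk \<tau> X i = map_pmf (\<lambda>y. y - X) (local_run A b blk i \<tau> X)"

definition server_rhs :: "(nat \<Rightarrow> real^'n) \<Rightarrow> real^'n \<Rightarrow> nat \<Rightarrow> real" where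
  "server_rhs \<Delta> X i = \<Delta> i \<bullet> (\<Delta> i + X)"

text \<open>
  In the server iteration \<open>d\<close> is fixed throughout the round, whereas \<open>x\<close> is the current iterate.
\<close>

definition server_step ::
  "nat set \<Rightarrow> (nat \<Rightarrow> real^'n) \<Rightarrow> (nat \<Rightarrow> real) \<Rightarrow> real^'n \<Rightarrow> (real^'n) pmf" where
  "server_step S \<Delta> d x =
     (if \<forall>i\<in>S. \<Delta> i = 0 then return_pmf x
      else map_pmf (\<lambda>i. rk_step (\<Delta> i) (d i) x) (pmf_of_set {i\<in>S. \<Delta> i \<noteq> 0}))"

primrec server_run ::
  "nat set \<Rightarrow> (nat \<Rightarrow> real^'n) \<Rightarrow> (nat \<Rightarrow> real) \<Rightarrow> nat \<Rightarrow> real^'n \<Rightarrow> (real^'n) pmf" where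
  "server_run S \<Delta> d 0 x = return_pmf x"
| "server_run S \<Delta> d (Suc k) x = bind_pmf (server_run S \<Delta> d k x) (server_step S \<Delta> d)"

definition client_subset :: "nat \<Rightarrow> nat \<Rightarrow> nat set pmf" where
  "client_subset M N = pmf_of_set {S. S \<subseteq> {1..M} \<and> card S = N}"

text \<open>
  Transition kernel of one federated round. \<open>Pi_pmf\<close> is the product distribution, so the updates
  of the sampled clients are independent; the default value 0 outside \<open>S\<close> is never used.
\<close>

definition fedrk_round ::
  "real^'n^'m \<Rightarrow> real^'m \<Rightarrow> ('m::finite \<Rightarrow> nat) \<Rightarrow> nat \<Rightarrow> nat \<Rightarrow> nat \<Rightarrow> nat \<Rightarrow> real^'n \<Rightarrow> (real^'n) pmf"
where
  "fedrk_round A b blk M N \<tau> \<tau>\<^sub>g X =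
     bind_pmf (client_subset M N) (\<lambda>S.
       bind_pmf (Pi_pmf S 0 (local_update A b blk \<tau> X)) (\<lambda>\<Delta>.
         server_run S \<Delta> (server_rhs \<Delta> X) \<tau>\<^sub>g X))"

text \<open>The law of the global model after \<open>t\<close> rounds, a Markov chain started at \<open>X0\<close>.\<close>

primrec fedrk ::
  "real^'n^'m \<Rightarrow> real^'m \<Rightarrow> ('m::finite \<Rightarrow> nat) \<Rightarrow> nat \<Rightarrow> nat \<Rightarrow> nat \<Rightarrow> nat \<Rightarrow> real^'n \<Rightarrow> nat \<Rightarrow> (real^'n) pmf"
where
  "fedrk A b blk M N \<tau> \<tau>\<^sub>g X0 0 = return_pmf X0"
| "fedrk A b blk M N \<tau> \<tau>\<^sub>g X0 (Suc t) =
     bind_pmf (fedrk A b blk M N \<tau> \<tau>\<^sub>g X0 t) (fedrk_round A b blk M N \<tau> \<tau>\<^sub>g)"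

lemma pmf_local_row:
  fixes A :: "real^'n^'m"
  assumes "\<exists>j\<in>block_rows blk i. A $ j \<noteq> 0"
  shows "pmf (local_row A blk i) j =
    (if j \<in> block_rows blk i then (norm (A $ j))\<^sup>2 / block_frob_sq A blk i else 0)"
proof -
  let ?f = "\<lambda>j. if j \<in> block_rows blk i then (norm (A $ j))\<^sup>2 / block_frob_sq A blk i else 0"
  obtain j0 where j0: "j0 \<in> block_rows blk i" "A $ j0 \<noteq> 0"
    using assms by blast
  have pos: "block_frob_sq A blk i > 0"
    unfolding block_frob_sq_def by (rule sum_pos2[OF _ j0(1)]) (use j0 in auto)
  have nn: "?f j \<ge> 0" for j
    using pos by simp
  have "(\<Sum>j\<in>UNIV. ?f j) = (\<Sum>j\<in>block_rows blk i. (norm (A $ j))\<^sup>2 / block_frob_sq A blk i)"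
    by (subst sum.If_cases) auto
  also have "\<dots> = 1"
    using pos by (simp add: block_frob_sq_def flip: sum_divide_distrib)
  finally have sum1: "(\<Sum>j\<in>UNIV. ?f j) = 1" .
  have "(\<integral>\<^sup>+j. ennreal (?f j) \<partial>count_space UNIV) = (\<Sum>j\<in>UNIV. ennreal (?f j))"
    by (rule nn_integral_count_space_finite) simp
  also have "\<dots> = 1"
    using sum1 by (subst sum_ennreal) (use nn in auto)
  finally show ?thesis
    unfolding local_row_def by (subst pmf_embed_pmf) (use nn in auto)
qed

text \<open>
  All laws have finite support, so expectations under \<open>fedrk\<close> are finite sums.
\<close>

lemma finite_set_pmf_fedrk:
  fixes A :: "real^'n^'m"
  assumes "N \<le> M"
  shows "finite (set_pmf (fedrk A b blk M N \<tau> \<tau>\<^sub>g X0 t))"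
proof -
  have loc_step: "finite (set_pmf (local_step A b blk i x))" for i and x :: "real^'n"
    by (simp add: local_step_def)
  have loc: "finite (set_pmf (local_run A b blk i k x))" for i k and x :: "real^'n"
    by (induction k) (simp_all add: loc_step)
  have upd: "finite (set_pmf (local_update A b blk \<tau> X i))" for X i
    by (simp add: local_update_def loc)
  have srv_step: "finite (set_pmf (server_step S \<Delta> d x))" if "finite S"
    for S d x and \<Delta> :: "nat \<Rightarrow> real^'n"
  proof (cases "\<forall>i\<in>S. \<Delta> i = 0")
    case True
    then show ?thesis by (simp add: server_step_def)
  next
    case False
    then have "set_pmf (pmf_of_set {i\<in>S. \<Delta> i \<noteq> 0}) = {i\<in>S. \<Delta> i \<noteq> 0}"
      using that by (intro set_pmf_of_set) auto
    then show ?thesis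
      using False that by (simp add: server_step_def)
  qed
  have srv: "finite (set_pmf (server_run S \<Delta> d k x))" if "finite S"
    for S d k x and \<Delta> :: "nat \<Rightarrow> real^'n"
    by (induction k) (simp_all add: srv_step that)
  have fin: "finite {S. S \<subseteq> {1..M} \<and> card S = N}"
    by (rule finite_subset[of _ "Pow {1..M}"]) auto
  have ne: "{S. S \<subseteq> {1..M} \<and> card S = N} \<noteq> {}"
    using obtain_subset_with_card_n[of N "{1..M}"] assms by auto
  have set_cs: "set_pmf (client_subset M N) = {S. S \<subseteq> {1..M} \<and> card S = N}"
    using fin ne by (simp add: client_subset_def)
  have rnd: "finite (set_pmf (fedrk_round A b blk M N \<tau> \<tau>\<^sub>g X))" for X
    unfolding fedrk_round_def set_bind_pmf set_cs
  proof (intro finite_UN_I fin)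
    fix S assume "S \<in> {S. S \<subseteq> {1..M} \<and> card S = N}"
    then have S: "finite S"
      using finite_subset by blast
    show "finite (set_pmf (Pi_pmf S 0 (local_update A b blk \<tau> X)))"
      using S upd by (subst set_Pi_pmf) (auto intro!: finite_PiE_dflt)
    show "finite (set_pmf (server_run S \<Delta> (server_rhs \<Delta> X) \<tau>\<^sub>g X))" for \<Delta>
      by (rule srv[OF S])
  qed
  show ?thesis
    by (induction t) (simp_all add: rnd)
qed

end

theory Submission
  imports Defs
begin

text \<open>
  Since \<open>A *v x = b\<close> is solved by \<open>0\<close>, we have \<open>b = 0\<close>, and every local Kaczmarz step is an
  orthogonal projection onto a hyperplane through the origin. It never increases the norm, and
  projecting \<open>x\<close> along the row \<open>a\<close> lowers \<open>\<parallel>x\<parallel>\<^sup>2\<close> by \<open>\<langle>a, x\<rangle>\<^sup>2 / \<parallel>a\<parallel>\<^sup>2\<close>. The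
  row weights \<open>\<parallel>a\<parallel>\<^sup>2 / \<parallel>A\<^sub>i\<parallel>\<^sub>F\<^sup>2\<close> cancel the denominator, so one step of client \<open>i\<close> lowers
  \<open>\<parallel>x\<parallel>\<^sup>2\<close> by exactly \<open>\<parallel>A\<^sub>i x\<parallel>\<^sup>2 / \<parallel>A\<^sub>i\<parallel>\<^sub>F\<^sup>2\<close> in expectation; the further local steps do no
  harm (\<open>expectation_local_run_le\<close>).

  The right-hand sides of the server system are chosen so that a single server step with row
  \<open>i\<close> lands on \<open>X + \<Delta> i\<close>, the final model of client \<open>i\<close>. The server therefore adopts the model of
  a uniformly chosen client among those that moved. Clients that did not move have not lowered
  the squared norm, so ignoring them can only raise the average decrease: it is at least
  the average over all sampled clients (\<open>expectation_server_run_le\<close>).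

  A uniformly chosen member of a uniformly chosen \<open>N\<close>-subset is a uniformly chosen client, hence a
  round lowers the squared norm in expectation by at least the average of
  \<open>\<parallel>A\<^sub>i X\<parallel>\<^sup>2 / \<parallel>A\<^sub>i\<parallel>\<^sub>F\<^sup>2\<close> over all clients (\<open>expectation_fedrk_round_le\<close>), which is at least
  \<open>\<parallel>A X\<parallel>\<^sup>2 / (M * \<parallel>A\<parallel>\<^sub>F\<^sup>2)\<close> (\<open>sum_expected_decrease_ge\<close>). Uniqueness of the solution makes
  \<open>A\<close> injective, so \<open>\<parallel>A X\<parallel> \<ge> \<kappa> * \<parallel>X\<parallel>\<close> for some \<open>\<kappa> > 0\<close>, and each round contracts the
  expected squared norm by the factor \<open>1 - \<kappa>\<^sup>2 / (M * \<parallel>A\<parallel>\<^sub>F\<^sup>2)\<close>, whatever the current model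
  is. The rate follows by conditioning on the current model, round by round.
\<close>

section \<open>Expectations over finitely supported laws\<close>

lemma expectation_bind_pmf_le:
  fixes h :: "'b \<Rightarrow> real"
  assumes "finite (set_pmf p)"
    and "\<And>x. x \<in> set_pmf p \<Longrightarrow> finite (set_pmf (f x))"
    and "\<And>x. x \<in> set_pmf p \<Longrightarrow> measure_pmf.expectation (f x) h \<le> g x"
  shows "measure_pmf.expectation (bind_pmf p f) h \<le> measure_pmf.expectation p g"
proof -
  have "measure_pmf.expectation (bind_pmf p f) h
      = (\<Sum>a\<in>set_pmf p. pmf p a *\<^sub>R measure_pmf.expectation (f a) h)"
    using assms(1,2) by (intro pmf_expectation_bind) auto
  also have "\<dots> \<le> (\<Sum>a\<in>set_pmf p. pmf p a *\<^sub>R g a)"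
    by (intro sum_mono) (simp add: assms(3) mult_left_mono)
  also have "\<dots> = measure_pmf.expectation p g"
    using assms(1) by (intro integral_measure_pmf[symmetric]) auto
  finally show ?thesis .
qed

section \<open>Local iterations\<close>

text \<open>
  The right-hand side uses \<open>c / 0 = 0\<close>: for \<open>a = 0\<close> the step does nothing and the decrease
  vanishes.
\<close>

lemma norm_sq_rk_step_0:
  "(norm (rk_step a 0 x))\<^sup>2 = (norm x)\<^sup>2 - (a \<bullet> x)\<^sup>2 / (norm a)\<^sup>2"
proof (cases "a = 0")
  case False
  define c where "c = (a \<bullet> x) / (a \<bullet> a)"
  have "(norm (rk_step a 0 x))\<^sup>2 = (x - c *\<^sub>R a) \<bullet> (x - c *\<^sub>R a)"
    by (simp add: rk_step_def c_def power2_norm_eq_inner)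
  also have "\<dots> = x \<bullet> x - 2 * c * (a \<bullet> x) + c * (c * (a \<bullet> a))"
    by (simp add: inner_diff_left inner_diff_right inner_commute[of x a] algebra_simps)
  also have "c * (a \<bullet> a) = a \<bullet> x"
    using False by (simp add: c_def)
  finally show ?thesis
    unfolding power2_norm_eq_inner by (simp add: c_def power2_eq_square)
qed (simp add: rk_step_def)

lemma norm_rk_step_0_le: "norm (rk_step a 0 x) \<le> norm x"
  by (rule power2_le_imp_le) (simp_all add: norm_sq_rk_step_0)

text \<open>
  This is \<open>\<parallel>A\<^sub>i x\<parallel>\<^sup>2 / \<parallel>A\<^sub>i\<parallel>\<^sub>F\<^sup>2\<close>, written without forming the submatrix \<open>A\<^sub>i\<close>; it is \<open>0\<close> for \<open>A\<^sub>i = 0\<close>.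
\<close>

definition expected_decrease :: "real^'n^'m \<Rightarrow> ('m::finite \<Rightarrow> nat) \<Rightarrow> nat \<Rightarrow> real^'n \<Rightarrow> real" where
  "expected_decrease A blk i x =
     (\<Sum>j\<in>block_rows blk i. (A $ j \<bullet> x)\<^sup>2) / block_frob_sq A blk i"

text \<open>
  The sampling probability \<open>\<parallel>a\<^sub>j\<parallel>\<^sup>2 / \<parallel>A\<^sub>i\<parallel>\<^sub>F\<^sup>2\<close> cancels the factor \<open>1 / \<parallel>a\<^sub>j\<parallel>\<^sup>2\<close> in the decrease
  caused by row \<open>j\<close>; zero rows contribute nothing on either side.
\<close>

lemma expectation_local_step:
  fixes A :: "real^'n^'m"
  shows "measure_pmf.expectation (local_step A 0 blk i x) (\<lambda>y. (norm y)\<^sup>2)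
    = (norm x)\<^sup>2 - expected_decrease A blk i x"
proof (cases "\<forall>j\<in>block_rows blk i. A $ j = 0")
  case True
  then show ?thesis
    by (simp add: local_step_def expected_decrease_def)
next
  case False
  let ?p = "local_row A blk i"
  have fin: "integrable (measure_pmf ?p) f" for f :: "'m \<Rightarrow> real"
    by (intro integrable_measure_pmf_finite) simp
  have "measure_pmf.expectation ?p (\<lambda>j. (A $ j \<bullet> x)\<^sup>2 / (norm (A $ j))\<^sup>2)
      = (\<Sum>j\<in>UNIV. pmf ?p j * ((A $ j \<bullet> x)\<^sup>2 / (norm (A $ j))\<^sup>2))"
    by (subst integral_measure_pmf[of UNIV]) auto
  also have "\<dots> = (\<Sum>j\<in>UNIV. if j \<in> block_rows blk i
      then (A $ j \<bullet> x)\<^sup>2 / block_frob_sq A blk i else 0)"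
    using False by (intro sum.cong refl) (auto simp: pmf_local_row)
  also have "\<dots> = expected_decrease A blk i x"
    by (subst sum.If_cases) (auto simp: expected_decrease_def sum_divide_distrib)
  finally have "measure_pmf.expectation ?p (\<lambda>j. (A $ j \<bullet> x)\<^sup>2 / (norm (A $ j))\<^sup>2)
      = expected_decrease A blk i x" .
  moreover have "measure_pmf.expectation (local_step A 0 blk i x) (\<lambda>y. (norm y)\<^sup>2)
      = measure_pmf.expectation ?p (\<lambda>j. (norm x)\<^sup>2 - (A $ j \<bullet> x)\<^sup>2 / (norm (A $ j))\<^sup>2)"
    unfolding local_step_def if_not_P[OF False] by (simp add: norm_sq_rk_step_0)
  ultimately show ?thesis
    by (simp add: Bochner_Integration.integral_diff[OF fin fin])
qed

lemma expected_decrease_nonneg: "0 \<le> expected_decrease A blk i x"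
  by (simp add: expected_decrease_def block_frob_sq_def sum_nonneg)

lemma finite_set_local_step: "finite (set_pmf (local_step A b blk i x))"
  by (simp add: local_step_def)

lemma finite_set_local_run: "finite (set_pmf (local_run A b blk i k x))"
  by (induction k) (simp_all add: finite_set_local_step)

lemma norm_local_step_le: "y \<in> set_pmf (local_step A 0 blk i x) \<Longrightarrow> norm y \<le> norm x"
  by (auto simp: local_step_def norm_rk_step_0_le split: if_splits)

lemma norm_local_run_le: "y \<in> set_pmf (local_run A 0 blk i k x) \<Longrightarrow> norm y \<le> norm x"
proof (induction k arbitrary: y)
  case (Suc k)
  then show ?case
    using norm_local_step_le order_trans by fastforce
qed simp

text \<open>The first step yields the decrease; later steps are projections and keep it.\<close>

lemma expectation_local_run_le:
  "measure_pmf.expectation (local_run A 0 blk i (Suc k) x) (\<lambda>y. (norm y)\<^sup>2)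
     \<le> (norm x)\<^sup>2 - expected_decrease A blk i x"
proof (induction k)
  case 0
  then show ?case
    by (simp add: bind_return_pmf expectation_local_step)
next
  case (Suc k)
  have "measure_pmf.expectation (local_run A 0 blk i (Suc (Suc k)) x) (\<lambda>y. (norm y)\<^sup>2)
      \<le> measure_pmf.expectation (local_run A 0 blk i (Suc k) x) (\<lambda>y. (norm y)\<^sup>2)"
    unfolding local_run.simps(2)[of A 0 blk i "Suc k"]
    by (rule expectation_bind_pmf_le[OF finite_set_local_run finite_set_local_step])
       (simp add: expectation_local_step expected_decrease_nonneg)
  also note Suc.IH
  finally show ?case .
qed

section \<open>The server step\<close>

lemma rk_step_server_rhs:
  assumes "\<Delta> i \<noteq> 0"
  shows "rk_step (\<Delta> i) (server_rhs \<Delta> X i) X = X + \<Delta> i"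
  using assms by (simp add: rk_step_def server_rhs_def inner_add_right power2_norm_eq_inner)

lemma server_run_1:
  "server_run S \<Delta> (server_rhs \<Delta> X) 1 X =
     (if \<forall>i\<in>S. \<Delta> i = 0 then return_pmf X
      else map_pmf (\<lambda>i. rk_step (\<Delta> i) (server_rhs \<Delta> X i) X) (pmf_of_set {i\<in>S. \<Delta> i \<noteq> 0}))"
  by (simp add: bind_return_pmf server_step_def)

lemma finite_set_server_run_1:
  assumes "finite S"
  shows "finite (set_pmf (server_run S \<Delta> (server_rhs \<Delta> X) 1 X))"
proof (cases "\<forall>i\<in>S. \<Delta> i = 0")
  case False
  then have "set_pmf (pmf_of_set {i\<in>S. \<Delta> i \<noteq> 0}) = {i\<in>S. \<Delta> i \<noteq> 0}"
    using assms by (intro set_pmf_of_set) auto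
  with False assms show ?thesis
    unfolding server_run_1 by simp
qed (unfold server_run_1, simp)

text \<open>
  The decreases \<open>\<parallel>X\<parallel>\<^sup>2 - \<parallel>X + \<Delta> i\<parallel>\<^sup>2\<close> are nonnegative and vanish for the ignored rows \<open>\<Delta> i = 0\<close>.
  Their sum over \<open>S\<close> is thus unchanged when these rows are dropped, while the number of terms
  shrinks.
\<close>

lemma expectation_server_run_le:
  assumes S: "finite S" and le: "\<And>i. i \<in> S \<Longrightarrow> norm (X + \<Delta> i) \<le> norm X"
  shows "measure_pmf.expectation (server_run S \<Delta> (server_rhs \<Delta> X) 1 X) (\<lambda>x. (norm x)\<^sup>2)
    \<le> (norm X)\<^sup>2 - (\<Sum>i\<in>S. (norm X)\<^sup>2 - (norm (X + \<Delta> i))\<^sup>2) / card S"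
proof (cases "\<forall>i\<in>S. \<Delta> i = 0")
  case True
  then show ?thesis
    unfolding server_run_1 by simp
next
  case False
  let ?J = "{i\<in>S. \<Delta> i \<noteq> 0}"
  let ?D = "\<lambda>i. (norm X)\<^sup>2 - (norm (X + \<Delta> i))\<^sup>2"
  have J: "finite ?J" "?J \<noteq> {}"
    using S False by auto
  then have card: "0 < card ?J" "card ?J \<le> card S"
    using S by (auto simp: card_gt_0_iff intro: card_mono)
  have nonneg: "0 \<le> (\<Sum>i\<in>S. ?D i)"
    using le by (intro sum_nonneg) (simp add: power_mono)
  have drop: "(\<Sum>i\<in>S. ?D i) = (\<Sum>i\<in>?J. ?D i)"
    using S by (intro sum.mono_neutral_right) auto
  have "measure_pmf.expectation (server_run S \<Delta> (server_rhs \<Delta> X) 1 X) (\<lambda>x. (norm x)\<^sup>2)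
      = (\<Sum>i\<in>?J. (norm (rk_step (\<Delta> i) (server_rhs \<Delta> X i) X))\<^sup>2) / card ?J"
    unfolding server_run_1 if_not_P[OF False] integral_map_pmf
    using J by (rule integral_pmf_of_set[rotated])
  also have "(\<Sum>i\<in>?J. (norm (rk_step (\<Delta> i) (server_rhs \<Delta> X i) X))\<^sup>2)
      = (\<Sum>i\<in>?J. (norm (X + \<Delta> i))\<^sup>2)"
    by (intro sum.cong refl) (simp add: rk_step_server_rhs)
  also have "\<dots> / card ?J = (norm X)\<^sup>2 - (\<Sum>i\<in>?J. ?D i) / card ?J"
    using card by (simp add: sum_subtractf field_simps)
  also have "\<dots> \<le> (norm X)\<^sup>2 - (\<Sum>i\<in>S. ?D i) / card S"
    unfolding drop[symmetric] using card nonneg by (simp add: divide_left_mono)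
  finally show ?thesis .
qed

section \<open>Averaging over the sampled clients\<close>

text \<open>
  Every client lies in the same number \<open>(M - 1) choose (N - 1)\<close> of \<open>N\<close>-subsets, that is, in the
  fraction \<open>N / M\<close> of them.
\<close>

lemma expectation_client_subset_average:
  fixes f :: "nat \<Rightarrow> real"
  assumes "1 \<le> N" and "N \<le> M"
  shows "measure_pmf.expectation (client_subset M N) (\<lambda>S. (\<Sum>i\<in>S. f i) / N) = (\<Sum>i=1..M. f i) / M"
proof -
  let ?F = "{S. S \<subseteq> {1..M} \<and> card S = N}"
  have fin: "finite ?F"
    by (rule finite_subset[of _ "Pow {1..M}"]) auto
  have cardF: "card ?F = M choose N"
    using n_subsets[of "{1..M}" N] by simp
  then have pos: "0 < card ?F"
    using assms(2) by simp
  then have ne: "?F \<noteq> {}"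
    by (metis card.empty less_irrefl)
  have count: "card {S\<in>?F. i \<in> S} = (M - 1) choose (N - 1)" if i: "i \<in> {1..M}" for i
  proof -
    let ?G = "{S. S \<subseteq> {1..M} - {i} \<and> card S = N - 1}"
    have "bij_betw (insert i) ?G {S\<in>?F. i \<in> S}"
    proof (rule bij_betw_byWitness[where f' = "\<lambda>S. S - {i}"])
      show "\<forall>S\<in>?G. insert i S - {i} = S" "\<forall>S\<in>{S\<in>?F. i \<in> S}. insert i (S - {i}) = S"
        by auto
      show "insert i ` ?G \<subseteq> {S\<in>?F. i \<in> S}"
      proof safe
        fix S assume S: "S \<subseteq> {1..M} - {i}" "card S = N - 1"
        then have "finite S" "i \<notin> S"
          using finite_subset by blast+
        with S assms(1) show "card (insert i S) = N"
          by simp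
      qed (use i in auto)
      show "(\<lambda>S. S - {i}) ` {S\<in>?F. i \<in> S} \<subseteq> ?G"
        by auto
    qed
    then have "card {S\<in>?F. i \<in> S} = card ?G"
      by (simp add: bij_betw_same_card)
    also have "\<dots> = (M - 1) choose (N - 1)"
      using n_subsets[of "{1..M} - {i}" "N - 1"] i by simp
    finally show ?thesis .
  qed
  have "(\<Sum>S\<in>?F. \<Sum>i\<in>S. f i) = (\<Sum>S\<in>?F. \<Sum>i\<in>{i\<in>{1..M}. i \<in> S}. f i)"
    by (intro sum.cong) auto
  also have "\<dots> = (\<Sum>i=1..M. \<Sum>S\<in>{S\<in>?F. i \<in> S}. f i)"
    by (rule sum.swap_restrict[OF fin]) simp
  also have "\<dots> = (\<Sum>i=1..M. real ((M - 1) choose (N - 1)) * f i)"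
    by (intro sum.cong refl) (simp only: sum_constant count)
  also have "\<dots> = real ((M - 1) choose (N - 1)) * (\<Sum>i=1..M. f i)"
    by (simp add: sum_distrib_left)
  finally have total: "(\<Sum>S\<in>?F. \<Sum>i\<in>S. f i)
      = real ((M - 1) choose (N - 1)) * (\<Sum>i=1..M. f i)" .
  have "real N * real (M choose N) = real M * real ((M - 1) choose (N - 1))"
    using times_binomial_minus1_eq[of N M] assms(1) by (metis of_nat_mult zero_less_one less_le_trans)
  moreover have "measure_pmf.expectation (client_subset M N) (\<lambda>S. (\<Sum>i\<in>S. f i) / N)
      = real ((M - 1) choose (N - 1)) * (\<Sum>i=1..M. f i) / (real N * real (M choose N))"
    unfolding client_subset_def integral_pmf_of_set[OF ne fin] cardF
    by (simp only: total divide_divide_eq_left flip: sum_divide_distrib)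
  ultimately show ?thesis
    using assms by (simp add: field_simps)
qed

text \<open>
  Given the sampled clients, the marginals of the product law are the laws of the single updates,
  so linearity of expectation reduces the round to the local estimates.
\<close>

lemma expectation_fedrk_round_le:
  fixes A :: "real^'n^'m"
  assumes "1 \<le> T" and "1 \<le> N" and "N \<le> M"
  shows "measure_pmf.expectation (fedrk_round A 0 blk M N T 1 X) (\<lambda>x. (norm x)\<^sup>2)
    \<le> (norm X)\<^sup>2 - (\<Sum>i=1..M. expected_decrease A blk i X) / M"
proof -
  let ?F = "{S. S \<subseteq> {1..M} \<and> card S = N}"
  let ?U = "local_update A 0 blk T X"
  let ?D = "\<lambda>\<Delta>. (norm X)\<^sup>2 - (norm (X + \<Delta>))\<^sup>2"
  have finF: "finite ?F"
    by (rule finite_subset[of _ "Pow {1..M}"]) auto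
  have "?F \<noteq> {}"
    using obtain_subset_with_card_n[of N "{1..M}"] assms(3) by auto
  with finF have supp: "set_pmf (client_subset M N) = ?F"
    by (simp add: client_subset_def)
  have finU: "finite (set_pmf (?U i))" for i
    by (simp add: local_update_def finite_set_local_run)
  have finPi: "finite (set_pmf (Pi_pmf S 0 ?U))" if "finite S" for S
    using that finU by (subst set_Pi_pmf) (auto intro!: finite_PiE_dflt)
  have upd: "expected_decrease A blk i X \<le> measure_pmf.expectation (?U i) ?D" for i
  proof -
    let ?p = "local_run A 0 blk i T X"
    have int: "integrable (measure_pmf ?p) g" for g :: "real^'n \<Rightarrow> real"
      by (intro integrable_measure_pmf_finite finite_set_local_run)
    have "measure_pmf.expectation (?U i) ?D
        = (norm X)\<^sup>2 - measure_pmf.expectation ?p (\<lambda>y. (norm y)\<^sup>2)"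
      by (simp add: local_update_def Bochner_Integration.integral_diff[OF int int])
    moreover obtain k where "T = Suc k"
      using assms(1) by (cases T) auto
    ultimately show ?thesis
      using expectation_local_run_le[of A blk i k X] by simp
  qed
  have given_S: "measure_pmf.expectation
        (bind_pmf (Pi_pmf S 0 ?U) (\<lambda>\<Delta>. server_run S \<Delta> (server_rhs \<Delta> X) 1 X)) (\<lambda>x. (norm x)\<^sup>2)
      \<le> (norm X)\<^sup>2 - (\<Sum>i\<in>S. expected_decrease A blk i X) / N" (is "?lhs \<le> _")
    if S: "S \<in> ?F" for S
  proof -
    have finS: "finite S"
      using S finite_subset by blast
    have int: "integrable (measure_pmf (Pi_pmf S 0 ?U)) g" for g :: "(nat \<Rightarrow> real^'n) \<Rightarrow> real"
      by (intro integrable_measure_pmf_finite finPi finS)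
    have "?lhs \<le> measure_pmf.expectation (Pi_pmf S 0 ?U)
        (\<lambda>\<Delta>. (norm X)\<^sup>2 - (\<Sum>i\<in>S. ?D (\<Delta> i)) / card S)"
    proof (rule expectation_bind_pmf_le[OF finPi[OF finS] finite_set_server_run_1[OF finS]])
      fix \<Delta> assume "\<Delta> \<in> set_pmf (Pi_pmf S 0 ?U)"
      then have "\<Delta> i \<in> set_pmf (?U i)" if "i \<in> S" for i
        using that finS by (auto simp: set_Pi_pmf PiE_dflt_def)
      then have "norm (X + \<Delta> i) \<le> norm X" if "i \<in> S" for i
        using that by (fastforce simp: local_update_def dest: norm_local_run_le)
      then show "measure_pmf.expectation (server_run S \<Delta> (server_rhs \<Delta> X) 1 X) (\<lambda>x. (norm x)\<^sup>2)
          \<le> (norm X)\<^sup>2 - (\<Sum>i\<in>S. ?D (\<Delta> i)) / card S"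
        by (rule expectation_server_run_le[OF finS])
    qed
    also have "\<dots> = (norm X)\<^sup>2
        - measure_pmf.expectation (Pi_pmf S 0 ?U) (\<lambda>\<Delta>. \<Sum>i\<in>S. ?D (\<Delta> i)) / card S"
      by (subst Bochner_Integration.integral_diff[OF int int]) simp
    also have "measure_pmf.expectation (Pi_pmf S 0 ?U) (\<lambda>\<Delta>. \<Sum>i\<in>S. ?D (\<Delta> i))
        = (\<Sum>i\<in>S. measure_pmf.expectation (Pi_pmf S 0 ?U) (\<lambda>\<Delta>. ?D (\<Delta> i)))"
      by (rule Bochner_Integration.integral_sum[OF int])
    also have "\<dots> = (\<Sum>i\<in>S. measure_pmf.expectation (?U i) ?D)"
    proof (rule sum.cong[OF refl])
      fix i assume "i \<in> S"
      then have "?U i = map_pmf (\<lambda>\<Delta>. \<Delta> i) (Pi_pmf S 0 ?U)"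
        using Pi_pmf_component[OF finS, of i 0 ?U] by simp
      then show "measure_pmf.expectation (Pi_pmf S 0 ?U) (\<lambda>\<Delta>. ?D (\<Delta> i))
          = measure_pmf.expectation (?U i) ?D"
        by (simp only: integral_map_pmf)
    qed
    also have "(norm X)\<^sup>2 - (\<Sum>i\<in>S. measure_pmf.expectation (?U i) ?D) / card S
        \<le> (norm X)\<^sup>2 - (\<Sum>i\<in>S. expected_decrease A blk i X) / card S"
      by (intro diff_left_mono divide_right_mono sum_mono upd) simp
    finally show ?thesis
      using S by simp
  qed
  have int: "integrable (measure_pmf (client_subset M N)) g" for g :: "nat set \<Rightarrow> real"
    by (intro integrable_measure_pmf_finite) (simp add: supp finF)
  have "measure_pmf.expectation (fedrk_round A 0 blk M N T 1 X) (\<lambda>x. (norm x)\<^sup>2)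
      \<le> measure_pmf.expectation (client_subset M N)
          (\<lambda>S. (norm X)\<^sup>2 - (\<Sum>i\<in>S. expected_decrease A blk i X) / N)"
    unfolding fedrk_round_def
  proof (rule expectation_bind_pmf_le)
    show "finite (set_pmf (client_subset M N))"
      by (simp add: supp finF)
    fix S assume S: "S \<in> set_pmf (client_subset M N)"
    then have "finite S"
      using supp finite_subset by blast
    then show "finite (set_pmf (bind_pmf (Pi_pmf S 0 ?U)
        (\<lambda>\<Delta>. server_run S \<Delta> (server_rhs \<Delta> X) 1 X)))"
      unfolding set_bind_pmf by (intro finite_UN_I finPi finite_set_server_run_1)
  qed (use given_S supp in blast)
  also have "\<dots> = (norm X)\<^sup>2 - (\<Sum>i=1..M. expected_decrease A blk i X) / M"
    using expectation_client_subset_average[OF assms(2,3), of "\<lambda>i. expected_decrease A blk i X"]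
    by (subst Bochner_Integration.integral_diff[OF int int]) simp
  finally show ?thesis .
qed

section \<open>Contraction\<close>

definition frob_sq :: "real^'n^'m \<Rightarrow> real" where
  "frob_sq A = (\<Sum>j\<in>UNIV. (norm (A $ j))\<^sup>2)"

text \<open>
  Each block norm is at most \<open>\<parallel>A\<parallel>\<^sub>F\<close>, and the blocks partition the rows of \<open>A\<close>. A block without
  nonzero row, for which the quotient is \<open>0 / 0 = 0\<close>, contributes nothing to \<open>\<parallel>A x\<parallel>\<^sup>2\<close>.
\<close>

lemma sum_expected_decrease_ge:
  fixes A :: "real^'n^'m"
  assumes "range blk \<subseteq> {1..M}"
  shows "(norm (A *v x))\<^sup>2 / frob_sq A \<le> (\<Sum>i=1..M. expected_decrease A blk i x)"
proof -
  have "(norm (A *v x))\<^sup>2 = (\<Sum>j\<in>UNIV. (A $ j \<bullet> x)\<^sup>2)"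
    unfolding power2_norm_eq_inner inner_vec_def[of "A *v x"] matrix_vector_mul_component
    by (simp add: power2_eq_square)
  also have "\<dots> = (\<Sum>i=1..M. \<Sum>j\<in>block_rows blk i. (A $ j \<bullet> x)\<^sup>2)"
    using sum.group[of UNIV "{1..M}" blk "\<lambda>j. (A $ j \<bullet> x)\<^sup>2"] assms
    by (simp add: block_rows_def)
  finally have "(norm (A *v x))\<^sup>2 / frob_sq A
      = (\<Sum>i=1..M. (\<Sum>j\<in>block_rows blk i. (A $ j \<bullet> x)\<^sup>2) / frob_sq A)"
    by (simp add: sum_divide_distrib)
  also have "\<dots> \<le> (\<Sum>i=1..M. expected_decrease A blk i x)"
  proof (rule sum_mono)
    fix i
    show "(\<Sum>j\<in>block_rows blk i. (A $ j \<bullet> x)\<^sup>2) / frob_sq A \<le> expected_decrease A blk i x"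
    proof (cases "\<forall>j\<in>block_rows blk i. A $ j = 0")
      case True
      then show ?thesis
        by (simp add: expected_decrease_def)
    next
      case False
      then obtain j where "j \<in> block_rows blk i" "A $ j \<noteq> 0"
        by blast
      then have "0 < block_frob_sq A blk i"
        unfolding block_frob_sq_def by (intro sum_pos2[of _ j]) auto
      moreover have "block_frob_sq A blk i \<le> frob_sq A"
        unfolding block_frob_sq_def frob_sq_def by (intro sum_mono2) auto
      ultimately show ?thesis
        unfolding expected_decrease_def by (intro divide_left_mono sum_nonneg) auto
    qed
  qed
  finally show ?thesis .
qed

lemma expectation_fedrk_le_power:
  fixes A :: "real^'n^'m"
  assumes "N \<le> M" and "0 \<le> \<beta>"
    and round: "\<And>X. measure_pmf.expectation (fedrk_round A b blk M N \<tau> \<tau>\<^sub>g X) (\<lambda>x. (norm x)\<^sup>2)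
      \<le> \<beta> * (norm X)\<^sup>2"
  shows "measure_pmf.expectation (fedrk A b blk M N \<tau> \<tau>\<^sub>g X0 t) (\<lambda>x. (norm x)\<^sup>2)
    \<le> \<beta> ^ t * (norm X0)\<^sup>2"
proof (induction t)
  case (Suc t)
  have fin: "finite (set_pmf (fedrk_round A b blk M N \<tau> \<tau>\<^sub>g X))" for X
    using finite_set_pmf_fedrk[OF assms(1), of A b blk \<tau> \<tau>\<^sub>g X 1] by (simp add: bind_return_pmf)
  have "measure_pmf.expectation (fedrk A b blk M N \<tau> \<tau>\<^sub>g X0 (Suc t)) (\<lambda>x. (norm x)\<^sup>2)
      \<le> measure_pmf.expectation (fedrk A b blk M N \<tau> \<tau>\<^sub>g X0 t) (\<lambda>x. \<beta> * (norm x)\<^sup>2)"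
    unfolding fedrk.simps(2)
    by (rule expectation_bind_pmf_le[OF finite_set_pmf_fedrk[OF assms(1)] fin round])
  also have "\<dots> = \<beta> * measure_pmf.expectation (fedrk A b blk M N \<tau> \<tau>\<^sub>g X0 t) (\<lambda>x. (norm x)\<^sup>2)"
    by simp
  also have "\<dots> \<le> \<beta> * (\<beta> ^ t * (norm X0)\<^sup>2)"
    using Suc.IH assms(2) by (rule mult_left_mono)
  finally show ?case
    by (simp add: mult.assoc)
qed simp

theorem theorem1:
  fixes A :: "real^'n^'m" and b :: "real^'m" and blk :: "'m \<Rightarrow> nat"
    and M N T :: nat and X0 :: "real^'n"
  assumes overdetermined: "CARD('n) \<le> CARD('m)"
    and partition: "range blk = {1..M}"
    and unique_solution: "\<And>x. A *v x = b \<longleftrightarrow> x = 0"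
    and "1 \<le> T"
    and "1 \<le> N" and "N \<le> M"
  shows "\<exists>\<beta>. 0 < \<beta> \<and> \<beta> < 1 \<and>
    (\<forall>t. measure_pmf.expectation (fedrk A b blk M N T 1 X0 (t + 1)) (\<lambda>x. (norm x)\<^sup>2)
           \<le> \<beta> ^ (t + 1) * (norm X0)\<^sup>2)"
proof -
  have b: "b = 0"
    using unique_solution[of 0] by simp
  have "inj ((*v) A)"
    using unique_solution b by (subst linear_injective_0) auto
  then obtain \<kappa> where \<kappa>: "0 < \<kappa>" "\<And>x. \<kappa> * norm x \<le> norm (A *v x)"
    using linear_inj_bounded_below_pos[of "(*v) A"] by auto
  have "A \<noteq> 0"
  proof
    assume "A = 0"
    then have "axis undefined 1 = (0 :: real^'n)"
      using unique_solution[of "axis undefined 1"] b by simp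
    then show False
      by (simp add: axis_eq_0_iff)
  qed
  then obtain j where "A $ j \<noteq> 0"
    by (metis vec_eq_iff zero_index)
  then have F: "0 < frob_sq A"
    unfolding frob_sq_def by (intro sum_pos2[of _ j]) auto
  define \<gamma> where "\<gamma> = \<kappa>\<^sup>2 / (M * frob_sq A)"
  have "0 < \<gamma>"
    using \<kappa>(1) F assms(5,6) by (simp add: \<gamma>_def)
  \<comment> \<open>The factor \<open>1 - \<gamma>\<close> may be \<open>0\<close>, for instance if \<open>n = M = 1\<close> and \<open>\<kappa>\<close> is optimal; the
    maximum keeps \<open>\<beta>\<close> positive.\<close>
  define \<beta> where "\<beta> = max (1 / 2) (1 - \<gamma>)"
  have \<beta>: "0 < \<beta>" "\<beta> < 1" "1 - \<gamma> \<le> \<beta>"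
    using \<open>0 < \<gamma>\<close> by (auto simp: \<beta>_def)
  have "measure_pmf.expectation (fedrk_round A b blk M N T 1 X) (\<lambda>x. (norm x)\<^sup>2) \<le> \<beta> * (norm X)\<^sup>2"
    for X
  proof -
    have "(\<kappa> * norm X)\<^sup>2 \<le> (norm (A *v X))\<^sup>2"
      using \<kappa> by (intro power_mono) auto
    then have "\<kappa>\<^sup>2 * (norm X)\<^sup>2 / frob_sq A \<le> (norm (A *v X))\<^sup>2 / frob_sq A"
      using F by (intro divide_right_mono) (auto simp: power_mult_distrib)
    also have "\<dots> \<le> (\<Sum>i=1..M. expected_decrease A blk i X)"
      using partition by (intro sum_expected_decrease_ge) simp
    finally have "\<kappa>\<^sup>2 * (norm X)\<^sup>2 / frob_sq A / M \<le> (\<Sum>i=1..M. expected_decrease A blk i X) / M"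
      by (rule divide_right_mono) simp
    moreover have "\<kappa>\<^sup>2 * (norm X)\<^sup>2 / frob_sq A / M = \<gamma> * (norm X)\<^sup>2"
      by (simp add: \<gamma>_def mult.commute)
    ultimately have "measure_pmf.expectation (fedrk_round A b blk M N T 1 X) (\<lambda>x. (norm x)\<^sup>2)
        \<le> (1 - \<gamma>) * (norm X)\<^sup>2"
      using expectation_fedrk_round_le[OF assms(4-6), of A blk X] b by (simp add: algebra_simps)
    also have "\<dots> \<le> \<beta> * (norm X)\<^sup>2"
      using \<beta>(3) by (intro mult_right_mono) auto
    finally show ?thesis .
  qed
  then have "measure_pmf.expectation (fedrk A b blk M N T 1 X0 (t + 1)) (\<lambda>x. (norm x)\<^sup>2)
      \<le> \<beta> ^ (t + 1) * (norm X0)\<^sup>2" for t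
    using \<beta>(1) by (intro expectation_fedrk_le_power \<open>N \<le> M\<close>) auto
  with \<beta>(1,2) show ?thesis
    by blast
qed

end
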